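(* Let $0<q<1$ and $\nu>-1$. Suppose $f\in\mathcal{L}_{q,1,\nu}$ and there is a constant $C>0$ such that $$|f(x)|\le Ce^{-\frac12x^2}\quad\forall x\in\mathbb{R}_q^+,\qquad |\mathcal{F}_{q,\nu}f(x)|\le Ce^{-\frac12x^2}\quad\forall x\in\mathbb{R}.$$ Then there exists $A\in\mathbb{R}$ such that $f(z)=A\,c_{q,\nu}\,\mathcal{F}_{q,\nu}\!\left(e^{-\frac12x^2}\right)(z)$ for all $z\in\mathbb{R}_q^+$ (the right-hand side, which makes sense for all $z\in\mathbb{C}$, thus extends $f$ to $\mathbb{C}$).
   Context: $\mathbb{R}_q^+=\{q^n: n\in\mathbb{Z}\}$. For $a\in\mathbb{C}$, $(a;q^2)_n=\prod_{k=0}^{n-1}(1-aq^{2k})$ and $(a;q^2)_\infty=\prod_{k\ge 0}(1-aq^{2k})$. Jackson integral: $\int_0^\infty f(t)\,d_qt=(1-q)\sum_{n\in\mathbb{Z}}q^nf(q^n)$. $\mathcal{L}_{q,1,\nu}$ is the space of functions $f:\mathbb{R}_q^+\to\mathbb{R}$ with $\int_0^\infty|f(x)|x^{2\nu+1}d_qx<\infty$. Normalized $q$-Bessel function (entire in $x$): $j_\nu(x,q^2)=\sum_{n=0}^\infty(-1)^n\frac{q^{n(n+1)}}{(q^{2\nu+2};q^2)_n(q^2;q^2)_n}x^{2n}$. Put $c_{q,\nu}=\frac{1}{1-q}\frac{(q^{2\nu+2};q^2)_\infty}{(q^2;q^2)_\infty}$. The $q$-Bessel Fourier transform is $\mathcal{F}_{q,\nu}f(z)=c_{q,\nu}\int_0^\infty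 f(t)j_\nu(zt,q^2)t^{2\nu+1}d_qt$; the same formula is used for every complex $z$ for which it converges absolutely (in particular for all $z\in\mathbb{C}$ when $|f(t)|\le Ce^{-at^2}$ on $\mathbb{R}_q^+$ with $a>0$). *)

theory Defs
  imports "HOL-Analysis.Analysis"
begin

definition qlattice :: "real \<Rightarrow> real set" where
  "qlattice q = range (\<lambda>n::int. q powi n)"

(* The base is a separate argument p; it is instantiated with q^2 below. *)
definition qpoch :: "'a \<Rightarrow> 'a \<Rightarrow> nat \<Rightarrow> 'a::comm_ring_1" where
  "qpoch a p n = (\<Prod>k<n. 1 - a * p ^ k)"

definition qpoch_inf :: "'a \<Rightarrow> 'a \<Rightarrow> 'a::real_normed_field" where
  "qpoch_inf a p = (\<Prod>k. 1 - a * p ^ k)"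

(* Absolute convergence of the bilateral series; only values on qlattice q matter. *)
definition jackson_integrable :: "real \<Rightarrow> (real \<Rightarrow> 'a::real_normed_vector) \<Rightarrow> bool" where
  "jackson_integrable q f \<longleftrightarrow> (\<lambda>n::int. q powi n * norm (f (q powi n))) summable_on UNIV"

definition jackson_integral :: "real \<Rightarrow> (real \<Rightarrow> 'a::real_normed_vector) \<Rightarrow> 'a" where
  "jackson_integral q f = (1 - q) *\<^sub>R (\<Sum>\<^sub>\<infinity>n::int. (q powi n) *\<^sub>R f (q powi n))"

(* A function on qlattice q is represented by any extension of it to the reals. *)
definition L1q :: "real \<Rightarrow> real \<Rightarrow> (real \<Rightarrow> real) set" where
  "L1q q \<nu> = {f. jackson_integrable q (\<lambda>x. \<bar>f x\<bar> * x powr (2 * \<nu> + 1))}"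

definition qbessel :: "real \<Rightarrow> real \<Rightarrow> complex \<Rightarrow> complex" where
  "qbessel q \<nu> x =
     (\<Sum>n. (-1) ^ n *
        complex_of_real (q ^ (n * (n + 1)) /
          (qpoch (q powr (2 * \<nu> + 2)) (q\<^sup>2) n * qpoch (q\<^sup>2) (q\<^sup>2) n)) * x ^ (2 * n))"

definition cq :: "real \<Rightarrow> real \<Rightarrow> real" where
  "cq q \<nu> = 1 / (1 - q) *
     (qpoch_inf (q powr (2 * \<nu> + 2)) (q\<^sup>2) / qpoch_inf (q\<^sup>2) (q\<^sup>2))"

definition qbessel_integrand :: "real \<Rightarrow> real \<Rightarrow> (real \<Rightarrow> real) \<Rightarrow> complex \<Rightarrow> real \<Rightarrow> complex" where
  "qbessel_integrand q \<nu> f z t =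
     complex_of_real (f t) * qbessel q \<nu> (z * complex_of_real t)
       * complex_of_real (t powr (2 * \<nu> + 1))"

(* Meaningful at those z where the integrand is jackson_integrable; an infinite sum that
   does not converge absolutely has the default value 0. *)
definition qbessel_transform :: "real \<Rightarrow> real \<Rightarrow> (real \<Rightarrow> real) \<Rightarrow> complex \<Rightarrow> complex" where
  "qbessel_transform q \<nu> f z =
     complex_of_real (cq q \<nu>) * jackson_integral q (qbessel_integrand q \<nu> f z)"

end

theory Submission
  imports
    Defs
    "HOL-Complex_Analysis.Complex_Analysis"
    "HOL-Real_Asymp.Real_Asymp"
begin

text \<open>The theorem holds with \<open>A = 0\<close>: the hypotheses force \<open>f = 0\<close> on the lattice. The power
  series coefficients of the transform decay like \<open>q\<close> to a quadratic power, since the Gaussian decay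
  of \<open>f\<close> along the lattice beats every \<open>q\<close> to the power \<open>- D m\<^sup>2\<close>; hence the transform is entire of
  order zero. Being bounded on the real axis, it is bounded by Phragmen--Lindelof, so constant by
  Liouville, and the decay on the real axis makes it vanish. Its coefficients are nonzero
  multiples of the even moments of the weights of \<open>f\<close>, and weights decaying this fast are
  determined by their moments.\<close>

section \<open>A half-plane Phragmen--Lindelof principle\<close>

text \<open>The real part of \<open>csqrt u\<close> is the square root of
  \<open>(norm u + Re u) / 2\<close>, so on the right half-plane it is comparable with the modulus
  of the root. The constant 1/2 is cruder than the optimal 1 / sqrt 2 but suffices.\<close>

lemma Re_csqrt_ge:
  assumes "Re u \<ge> 0"
  shows "Re (csqrt u) \<ge> sqrt (norm u) / 2"
proof -
  have "sqrt (norm u) / 2 = sqrt (norm u / 4)"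
    by (simp add: real_sqrt_divide)
  also have "\<dots> \<le> Re (csqrt u)"
    using assms by simp
  finally show ?thesis .
qed

text \<open>Damp \<open>f\<close> by \<open>exp (- \<epsilon> * csqrt (1 - \<i> * z))\<close>. In
  the upper half-plane the root has real part at least \<open>sqrt (norm z) / 2\<close>, which
  outweighs the growth of \<open>f\<close> taken with rate \<open>\<epsilon> / 4\<close>. The
  maximum principle on a large half-disc bounds the damped function by \<open>C\<close>, and then
  \<open>\<epsilon>\<close> tends to 0.\<close>

lemma phragmen_lindelof_upper_half_plane:
  assumes holf: "f holomorphic_on UNIV"
    and growth: "\<And>\<delta>. \<delta> > 0 \<Longrightarrow> \<exists>K. \<forall>z. norm (f z) \<le> K * exp (\<delta> * sqrt (norm z))"
    and real: "\<And>x. norm (f (complex_of_real x)) \<le> C"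
    and "C > 0" and "Im w \<ge> 0"
  shows "norm (f w) \<le> C"
proof -
  have key: "norm (f w) \<le> C * exp (\<epsilon> * Re (csqrt (1 - \<i> * w)))" if "\<epsilon> > 0" for \<epsilon>
  proof -
    obtain K where K: "\<And>z. norm (f z) \<le> K * exp (\<epsilon> / 4 * sqrt (norm z))"
      using growth[of "\<epsilon> / 4"] \<open>\<epsilon> > 0\<close> by auto
    \<comment> \<open>Since \<open>Re (1 - \<i> * z) = 1 + Im z\<close>, the summand 1 keeps the
      argument of \<open>csqrt\<close> off its branch cut for \<open>Im z > -1\<close>. Thus
      \<open>h\<close> is holomorphic across the real axis.\<close>
    define h where "h z = f z * exp (- of_real \<epsilon> * csqrt (1 - \<i> * z))" for z
    \<comment> \<open>On the arc of radius \<open>R\<close> the exponents combine to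
      \<open>\<epsilon> / 4 - \<epsilon> / 2\<close>. A large \<open>R\<close> therefore puts the
      arc below \<open>C\<close> and the point \<open>w\<close> inside the disc.\<close>
    have "((\<lambda>R. K * exp (- (\<epsilon> / 4) * sqrt R)) \<longlongrightarrow> 0) at_top"
      using \<open>\<epsilon> > 0\<close> by real_asymp
    then have "\<forall>\<^sub>F R in at_top. K * exp (- (\<epsilon> / 4) * sqrt R) < C"
      using \<open>C > 0\<close> by (rule order_tendstoD)
    moreover have "\<forall>\<^sub>F R in at_top. R > norm w"
      by (rule eventually_gt_at_top)
    ultimately have "\<forall>\<^sub>F R in at_top. K * exp (- (\<epsilon> / 4) * sqrt R) < C \<and> R > norm w"
      by (rule eventually_conj)
    then obtain R where R: "K * exp (- (\<epsilon> / 4) * sqrt R) < C" "R > norm w"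
      by (auto simp: eventually_at_top_linorder)
    have norm_h: "norm (h z) = norm (f z) * exp (- \<epsilon> * Re (csqrt (1 - \<i> * z)))" for z
      unfolding h_def norm_mult norm_exp_eq_Re by simp
    have Re_ge: "Re (csqrt (1 - \<i> * z)) \<ge> sqrt (norm z) / 2" if "Im z \<ge> 0" for z
    proof -
      have "norm z \<le> norm (1 - \<i> * z)"
        unfolding cmod_def using that by (auto simp: power2_eq_square algebra_simps)
      then have "sqrt (norm z) / 2 \<le> sqrt (norm (1 - \<i> * z)) / 2"
        by simp
      also have "\<dots> \<le> Re (csqrt (1 - \<i> * z))"
        using that by (intro Re_csqrt_ge) simp
      finally show ?thesis .
    qed
    have on_real: "norm (h z) \<le> C" if "Im z = 0" for z
    proof -
      have "norm (h z) \<le> norm (f z)"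
        unfolding norm_h using \<open>\<epsilon> > 0\<close> csqrt_principal[of "1 - \<i> * z"]
        by (intro mult_right_le_one_le) (auto simp: zero_le_mult_iff)
      also have "\<dots> \<le> C"
        using real[of "Re z"] that by (simp add: complex_is_Real_iff of_real_Re)
      finally show ?thesis .
    qed
    have on_arc: "norm (h z) \<le> C" if "Im z \<ge> 0" "norm z = R" for z
    proof -
      have "norm (h z) \<le> (K * exp (\<epsilon> / 4 * sqrt R)) * exp (- \<epsilon> * (sqrt R / 2))"
        unfolding norm_h using K[of z] Re_ge[of z] that \<open>\<epsilon> > 0\<close>
        by (intro mult_mono) (auto intro: order_trans[OF norm_ge_zero])
      also have "\<dots> = K * exp (- (\<epsilon> / 4) * sqrt R)"
        by (simp add: mult.assoc field_simps flip: exp_add)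
      finally show ?thesis using R by simp
    qed
    have "norm (h w) \<le> C"
    proof (cases "Im w = 0")
      case False
      define S where "S = ball 0 R \<inter> {z. Im z > 0}"
      have opS: "open S" unfolding S_def by (intro open_Int open_ball open_halfspace_Im_gt)
      have "closure S \<subseteq> cball 0 R \<inter> {z. Im z \<ge> 0}"
        unfolding S_def by (intro closure_minimal closed_Int closed_cball closed_halfspace_Im_ge) auto
      then have clS: "norm z \<le> R" "Im z \<ge> 0" if "z \<in> closure S" for z
        using that by auto
      have holh: "h holomorphic_on {z. Im z > -1}"
        unfolding h_def
        by (intro holomorphic_intros holomorphic_on_subset[OF holf]) (auto simp: complex_nonpos_Reals_iff)
      show ?thesis
      proof (rule maximum_modulus_frontier[of h S C w])
        show "h holomorphic_on interior S"
          using holh by (rule holomorphic_on_subset) (use interior_subset in \<open>force simp: S_def\<close>)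
        show "continuous_on (closure S) h"
          by (rule holomorphic_on_imp_continuous_on[OF holomorphic_on_subset[OF holh]])
            (use clS in force)
        show "bounded S" unfolding S_def by auto
        show "norm (h z) \<le> C" if "z \<in> frontier S" for z
        proof -
          have "z \<in> closure S" "z \<notin> S"
            using that opS by (auto simp: frontier_def interior_open)
          with clS[of z] show ?thesis
            using on_real[of z] on_arc[of z] by (force simp: S_def)
        qed
        show "w \<in> S" using False \<open>Im w \<ge> 0\<close> R by (auto simp: S_def)
      qed
    qed (rule on_real)
    then show ?thesis
      unfolding norm_h by (simp add: exp_minus field_simps)
  qed
  have "((\<lambda>\<epsilon>. C * exp (\<epsilon> * Re (csqrt (1 - \<i> * w)))) \<longlongrightarrow> C * exp (0 * Re (csqrt (1 - \<i> * w)))) (at_right 0)"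
    by (intro tendsto_intros)
  moreover have "\<forall>\<^sub>F \<epsilon> in at_right 0. norm (f w) \<le> C * exp (\<epsilon> * Re (csqrt (1 - \<i> * w)))"
    using key by (auto simp: eventually_at_filter)
  ultimately show ?thesis
    using tendsto_lowerbound[of _ _ "at_right (0::real)"] by (simp add: trivial_limit_at_right_real)
qed

text \<open>Both half-planes are covered by the preceding principle, the lower one through the
  reflection \<open>z\<close> to \<open>- z\<close>. So \<open>f\<close> is bounded, hence constant,
  and the limit along the positive axis identifies the constant.\<close>

lemma entire_small_growth_real_decay_eq_0:
  assumes holf: "f holomorphic_on UNIV"
    and growth: "\<And>\<delta>. \<delta> > 0 \<Longrightarrow> \<exists>K. \<forall>z. norm (f z) \<le> K * exp (\<delta> * sqrt (norm z))"
    and real: "\<And>x. norm (f (complex_of_real x)) \<le> C"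
    and lim: "((\<lambda>x. f (complex_of_real x)) \<longlongrightarrow> 0) at_top"
  shows "f z = 0"
proof -
  \<comment> \<open>The half-plane principle wants a strictly positive bound.\<close>
  define B where "B = max C 1"
  have B: "B > 0" "\<And>x. norm (f (complex_of_real x)) \<le> B"
    using real by (auto simp: B_def intro: max.coboundedI1)
  have "norm (f w) \<le> B" for w
  proof (cases "Im w \<ge> 0")
    case True
    then show ?thesis
      using phragmen_lindelof_upper_half_plane[OF holf growth B(2) B(1)] by blast
  next
    case False
    have "norm ((\<lambda>z. f (- z)) (- w)) \<le> B"
    proof (rule phragmen_lindelof_upper_half_plane[where f = "\<lambda>z. f (- z)"])
      show "(\<lambda>z. f (- z)) holomorphic_on UNIV"
        using holomorphic_on_compose_gen[of uminus UNIV f UNIV] holf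
        by (simp add: o_def holomorphic_on_minus)
      show "\<exists>K. \<forall>z. norm (f (- z)) \<le> K * exp (\<delta> * sqrt (norm z))" if "\<delta> > 0" for \<delta>
        using growth[OF that] by (metis norm_minus_cancel)
      show "norm (f (- complex_of_real x)) \<le> B" for x
        using B(2)[of "- x"] by simp
    qed (use B False in auto)
    then show ?thesis by simp
  qed
  then have "f constant_on UNIV"
    by (intro Liouville_theorem holf) (auto simp: bounded_iff)
  then obtain c where c: "\<And>z. f z = c" unfolding constant_on_def by auto
  then show ?thesis
    using lim by (simp add: tendsto_const_iff)
qed

section \<open>Weights of super-Gaussian decay on the lattice\<close>

text \<open>The large lattice points are those with negative \<open>k\<close>. For
  \<open>k >= 0\<close> the exponent is 0, because \<open>nat (- k) = 0\<close>, and only absolute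
  summability is asked. Below, \<open>D = 2\<close> serves the moment estimates and
  \<open>D = 8\<close> the determinacy argument.\<close>

definition rapid :: "real \<Rightarrow> (int \<Rightarrow> real) \<Rightarrow> bool" where
  "rapid q w \<longleftrightarrow> (\<forall>D::nat. (\<lambda>k. \<bar>w k\<bar> * (1 / q) ^ (D * (nat (- k))\<^sup>2)) summable_on UNIV)"

lemma summable_on_intI:
  fixes f :: "int \<Rightarrow> real"
  assumes "summable (\<lambda>n. \<bar>f (int n)\<bar>)" and "summable (\<lambda>n. \<bar>f (- int n)\<bar>)"
  shows "f summable_on UNIV"
proof -
  have "f summable_on range int"
    using assms(1) by (subst summable_on_reindex) (auto simp: o_def intro: norm_summable_imp_summable_on)
  moreover have "f summable_on range (\<lambda>n. - int n)"
    using assms(2) by (subst summable_on_reindex)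
      (auto simp: o_def inj_on_def intro: norm_summable_imp_summable_on)
  ultimately have "f summable_on (range int \<union> range (\<lambda>n. - int n))"
    by (rule summable_on_union)
  also have "range int \<union> range (\<lambda>n. - int n) = UNIV"
    by (auto intro: int_cases2)
  finally show ?thesis .
qed

text \<open>Towards 0 the positive exponent \<open>\<beta>\<close> gives a geometric series. Towards
  infinity, with \<open>q = exp (- l)\<close> and \<open>k = - n\<close>, the Gaussian decays doubly
  exponentially in \<open>n\<close> and so beats \<open>exp (D * l * n^2)\<close> for every
  \<open>D\<close>.\<close>

lemma rapid_if_gaussian_bound:
  assumes q: "0 < q" "q < 1" and "\<beta> > 0"
    and bound: "\<And>k. \<bar>w k\<bar> \<le> C * (q powi k) powr \<beta> * exp (- (1 / 2) * (q powi k)\<^sup>2)"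
  shows "rapid q w"
  unfolding rapid_def
proof
  fix D :: nat
  define l where "l = - ln q"
  have l: "l > 0" using q by (simp add: l_def)
  have inv_q: "1 / q = exp l" using q by (simp add: l_def exp_minus inverse_eq_divide)
  have C: "C \<ge> 0"
    using order_trans[OF abs_ge_zero bound[of 0]] by (simp add: zero_le_mult_iff)
  show "(\<lambda>k. \<bar>w k\<bar> * (1 / q) ^ (D * (nat (- k))\<^sup>2)) summable_on UNIV"
  proof (rule summable_on_intI)
    have s: "summable (\<lambda>n. C * (q powr \<beta>) ^ n)"
      using q \<open>\<beta> > 0\<close> by (intro summable_mult summable_geometric) (use powr_less_mono2[of \<beta> q 1] in simp)
    have le: "\<bar>w (int n)\<bar> \<le> C * (q powr \<beta>) ^ n" for n
    proof -
      have "\<bar>w (int n)\<bar> \<le> C * (q powi int n) powr \<beta> * exp (- (1 / 2) * (q powi int n)\<^sup>2)"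
        by (rule bound)
      also have "\<dots> \<le> C * (q powi int n) powr \<beta>"
        using C by (intro mult_right_le_one_le) auto
      also have "(q powi int n) powr \<beta> = (q powr \<beta>) ^ n"
      proof -
        have "(q powi int n) powr \<beta> = (q powr real n) powr \<beta>"
          using q by (simp add: powr_realpow)
        also have "\<dots> = (q powr \<beta>) powr real n"
          by (simp only: powr_powr mult.commute)
        also have "\<dots> = (q powr \<beta>) ^ n"
          using q by (intro powr_realpow) simp
        finally show ?thesis .
      qed
      finally show ?thesis .
    qed
    show "summable (\<lambda>n. \<bar>\<bar>w (int n)\<bar> * (1 / q) ^ (D * (nat (- int n))\<^sup>2)\<bar>)"
      by (rule summable_comparison_test'[OF s, of 0]) (use le in simp)
  next
    define g where
      "g n = C * exp (\<beta> * l * real n + real D * l * real n ^ 2 - exp (l * real n) ^ 2 / 2)" for n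
    have "g \<in> O(\<lambda>n. 1 / real n ^ 2)"
      unfolding g_def using l \<open>\<beta> > 0\<close> by real_asymp
    then have s: "summable g"
      by (rule summable_comparison_test_bigo[rotated])
        (use inverse_power_summable[of 2] in \<open>simp add: field_simps\<close>)
    have le: "\<bar>w (- int n)\<bar> * (1 / q) ^ (D * n\<^sup>2) \<le> g n" for n
    proof -
      have pw: "q powi (- int n) = exp (l * real n)"
      proof -
        have "q powi (- int n) = (1 / q) ^ n"
          using q by (simp add: power_int_minus power_one_over inverse_eq_divide)
        also have "\<dots> = exp (l * real n)"
          unfolding inv_q using exp_of_nat_mult[of n l] by (simp only: mult.commute)
        finally show ?thesis .
      qed
      have D: "(1 / q) ^ (D * n\<^sup>2) = exp (real D * l * real n ^ 2)"
        unfolding inv_q using exp_of_nat_mult[of "D * n\<^sup>2" l] by (simp add: mult_ac)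
      have "\<bar>w (- int n)\<bar> * (1 / q) ^ (D * n\<^sup>2) \<le>
        (C * exp (\<beta> * l * real n) * exp (- (1 / 2) * exp (l * real n) ^ 2)) * (1 / q) ^ (D * n\<^sup>2)"
        using bound[of "- int n"] assms unfolding pw
        by (intro mult_right_mono) (auto simp: powr_def mult_ac)
      also have "\<dots> = g n"
        unfolding D g_def by (simp add: mult.assoc flip: exp_add)
      finally show ?thesis .
    qed
    show "summable (\<lambda>n. \<bar>\<bar>w (- int n)\<bar> * (1 / q) ^ (D * (nat (- (- int n)))\<^sup>2)\<bar>)"
      by (rule summable_comparison_test'[OF s, of 0]) (use le q in simp)
  qed
qed

lemma rapid_bound_summable:
  assumes "rapid q w"
  shows "(\<lambda>k. \<bar>w k\<bar> * (1 / q) ^ (D * (nat (- k))\<^sup>2)) summable_on UNIV"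
  using assms by (simp add: rapid_def)

text \<open>This decouples the point from the exponent. For \<open>k = - m\<close> and
  \<open>c = 1 / sqrt q\<close> the left side is \<open>c ^ (4 * m * n)\<close>, and
  \<open>4 * m * n <= n^2 + 4 * m^2\<close> because \<open>(n - 2 * m)^2\<close> is nonnegative. The
  price in \<open>n\<close> is only the square root of the decay \<open>q ^ (n^2)\<close> available
  from the Bessel coefficients.\<close>

lemma lattice_power_le:
  fixes q :: real
  assumes "0 < q" "q < 1"
  shows "(q powi k) ^ (2 * n) \<le> (1 / sqrt q) ^ (n\<^sup>2) * (1 / q) ^ (2 * (nat (- k))\<^sup>2)"
proof (cases "k \<ge> 0")
  case True
  then obtain m where k: "k = int m" using nonneg_int_cases by blast
  have "(q powi k) ^ (2 * n) \<le> 1"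
    using assms by (simp add: k power_le_one)
  also have "1 \<le> (1 / sqrt q) ^ (n\<^sup>2)"
    using assms by (intro one_le_power) simp
  finally show ?thesis using k by simp
next
  case False
  then obtain m where k: "k = - int m"
    by (metis int_cases2 of_nat_0_le_iff)
  define c where "c = 1 / sqrt q"
  have c: "c \<ge> 1" using assms by (simp add: c_def)
  have q: "1 / q = c ^ 2" using assms by (simp add: c_def power_divide)
  have "(q powi k) ^ (2 * n) = ((1 / q) ^ m) ^ (2 * n)"
    using assms by (simp add: k power_int_minus power_one_over inverse_eq_divide)
  also have "\<dots> = c ^ (4 * m * n)"
    unfolding q by (simp flip: power_mult) (simp add: mult_ac)
  also have "\<dots> \<le> c ^ (n\<^sup>2 + 4 * m\<^sup>2)"
  proof (rule power_increasing[OF _ c])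
    have "0 \<le> (int n - 2 * int m)\<^sup>2" by simp
    then have "int (4 * m * n) \<le> int (n\<^sup>2 + 4 * m\<^sup>2)"
      by (simp add: power2_eq_square algebra_simps)
    then show "4 * m * n \<le> n\<^sup>2 + 4 * m\<^sup>2" by linarith
  qed
  also have "\<dots> = c ^ (n\<^sup>2) * (1 / q) ^ (2 * m\<^sup>2)"
    unfolding q by (simp add: power_add flip: power_mult)
  finally show ?thesis by (simp add: k c_def)
qed

lemma rapid_moment_le:
  assumes "0 < q" "q < 1"
  shows "norm (w k * (q powi k) ^ (2 * n)) \<le>
    (1 / sqrt q) ^ (n\<^sup>2) * (\<bar>w k\<bar> * (1 / q) ^ (2 * (nat (- k))\<^sup>2))"
  using mult_left_mono[OF lattice_power_le[of q k n], of "\<bar>w k\<bar>"] assms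
  by (simp add: abs_mult mult_ac)

lemma rapid_moment_abs_summable:
  assumes "0 < q" "q < 1" "rapid q w"
  shows "(\<lambda>k. norm (w k * (q powi k) ^ (2 * n))) summable_on UNIV"
  by (rule Infinite_Sum.abs_summable_on_comparison_test'[OF _ rapid_moment_le])
    (intro summable_on_cmult_right rapid_bound_summable assms)+

section \<open>Moment determinacy on the lattice\<close>

lemma convergent_prod_qpoch:
  fixes a p :: real
  assumes "\<bar>p\<bar> < 1"
  shows "convergent_prod (\<lambda>k. 1 - a * p ^ k)"
  using assms
  by (intro abs_convergent_prod_imp_convergent_prod summable_imp_abs_convergent_prod)
    (simp add: abs_mult power_abs summable_mult summable_geometric)

lemma qpoch_inf_nonzero:
  fixes a p :: real
  assumes "0 \<le> a" "a < 1" "0 \<le> p" "p < 1"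
  shows "qpoch_inf a p \<noteq> 0"
  unfolding qpoch_inf_def
proof (rule prodinf_nonzero[OF convergent_prod_qpoch])
  show "1 - a * p ^ k \<noteq> 0" for k
    using mult_left_le[of "p ^ k" a] power_le_one[of p k] assms by simp
qed (use assms in simp)

lemma qpoch_LIMSEQ:
  fixes a p :: real
  assumes "\<bar>p\<bar> < 1"
  shows "(\<lambda>n. qpoch a p n) \<longlonglongrightarrow> qpoch_inf a p"
  unfolding qpoch_inf_def qpoch_def
  using convergent_prod_LIMSEQ[OF convergent_prod_qpoch[OF assms]]
  \<comment> \<open>The library limit is over products up to and including \<open>n\<close>, whereas
    \<open>qpoch\<close> stops before \<open>n\<close>; hence the shift by one.\<close>
  by (subst filterlim_sequentially_Suc[symmetric]) (simp add: lessThan_Suc_atMost)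

text \<open>Vanishing even moments annihilate every polynomial in the squared lattice points. The
  extra power \<open>m\<close> strengthens the induction: \<open>pCons a P\<close> splits into a
  monomial and \<open>P\<close> with that power raised by one.\<close>

lemma has_sum_poly_lattice_zero:
  fixes w :: "int \<Rightarrow> real"
  assumes "0 < q" "q < 1" "rapid q w"
    and moments: "\<And>n. (\<Sum>\<^sub>\<infinity>k. w k * (q powi k) ^ (2 * n)) = 0"
  shows "((\<lambda>k. w k * (c * (q powi k)\<^sup>2) ^ m * poly P (c * (q powi k)\<^sup>2)) has_sum 0) UNIV"
proof (induction P arbitrary: m)
  case 0
  then show ?case by simp
next
  case (pCons a P)
  have "((\<lambda>k. w k * (q powi k) ^ (2 * m)) has_sum 0) UNIV"
    using has_sum_infsum[OF abs_summable_summable[OF rapid_moment_abs_summable[OF assms(1-3), of m]]]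
    by (simp only: moments)
  then have "((\<lambda>k. a * c ^ m * (w k * (q powi k) ^ (2 * m))) has_sum (a * c ^ m * 0)) UNIV"
    by (rule has_sum_cmult_right)
  from has_sum_add[OF this pCons.IH[of "Suc m"]] show ?case
    by (simp add: algebra_simps power_mult_distrib flip: power_mult)
qed

text \<open>Testing against \<open>y\<^sup>N (1 - p y) \<dots> (1 - p\<^sup>N y)\<close> with \<open>p = q\<^sup>2\<close> and
  \<open>y = (q\<^sup>k / q\<^sup>j)\<^sup>2\<close>: the product kills the \<open>N\<close> lattice points above \<open>q\<^sup>j\<close>, and \<open>y\<^sup>N\<close>
  suppresses those below, so that only the weight at \<open>q\<^sup>j\<close> survives as \<open>N \<rightarrow> \<infinity>\<close>.\<close>

lemma rapid_moments_zero_imp_zero: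
  fixes w :: "int \<Rightarrow> real"
  assumes q: "0 < q" "q < 1" and w: "rapid q w"
    and moments: "\<And>n. (\<Sum>\<^sub>\<infinity>k. w k * (q powi k) ^ (2 * n)) = 0"
  shows "w j = 0"
proof -
  define p where "p = q\<^sup>2"
  have p: "0 < p" "p < 1" using q by (auto simp: p_def power_less_one_iff)
  define y where "y k = p powi (k - j)" for k
  define T where "T N k = y k ^ N * qpoch (p * y k) p N" for N k
  \<comment> \<open>At distance \<open>L\<close> below \<open>j\<close> the test function is at most
    \<open>(1 / q) ^ (4 * L^2)\<close>, and \<open>L <= \<bar>j\<bar> + nat (- k)\<close> gives
    \<open>4 * L^2 <= 8 * j^2 + 8 * (nat (- k))^2\<close>. The constant \<open>K\<close> takes the
    part depending on \<open>j\<close>.\<close>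
  define K where "K = (1 / q) ^ (8 * (nat \<bar>j\<bar>)\<^sup>2)"
  have K1: "K \<ge> 1" unfolding K_def using q by (intro one_le_power) simp
  define G where "G k = K * (\<bar>w k\<bar> * (1 / q) ^ (8 * (nat (- k))\<^sup>2))" for k

  have y_eq: "y k = (1 / q powi j)\<^sup>2 * (q powi k)\<^sup>2" for k
    using q by (simp add: y_def p_def power_int_diff power_divide power2_eq_square
        power_int_mult_distrib)
  have qpoch_poly: "qpoch (p * y k) p N = poly (\<Prod>i<N. [:1, - (p ^ Suc i):]) (y k)" for k N
    by (simp add: qpoch_def poly_prod mult_ac)
  have T_sum: "((\<lambda>k. w k * T N k) has_sum 0) UNIV" for N
    using has_sum_poly_lattice_zero[OF q w moments, of "(1 / q powi j)\<^sup>2" N "\<Prod>i<N. [:1, - (p ^ Suc i):]"]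
    unfolding T_def qpoch_poly unfolding y_eq by (simp add: mult.assoc)

  have y_le: "0 < y k" "y k = p ^ l" if "k = j + int l" for k l
    using that p by (auto simp: y_def)
  have T_ge: "\<bar>T N k\<bar> \<le> y k ^ N" if kj: "k \<ge> j" for N k
  proof -
    obtain l where l: "k = j + int l" using kj zle_iff_zadd[of j k] by auto
    have y: "0 \<le> y k" "y k \<le> 1" using y_le[OF l] p by (simp_all add: power_le_one)
    have "\<bar>qpoch (p * y k) p N\<bar> \<le> 1"
      unfolding qpoch_def abs_prod
    proof (rule prod_le_1)
      fix i
      have "p ^ i \<le> 1" "0 \<le> p ^ i" using p by (simp_all add: power_le_one)
      then have "p * y k * p ^ i \<le> 1" "0 \<le> p * y k * p ^ i"
        using p y by (simp_all add: mult_le_one)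
      then show "0 \<le> \<bar>1 - p * y k * p ^ i\<bar> \<and> \<bar>1 - p * y k * p ^ i\<bar> \<le> 1"
        by auto
    qed
    then show ?thesis
      unfolding T_def abs_mult using y by (simp add: mult_left_le)
  qed
  have y_below: "y (j - int L) = (1 / p) ^ L" for L
    by (simp add: y_def power_int_minus power_one_over inverse_eq_divide)
  \<comment> \<open>Here \<open>y = p\<close> to the power \<open>- L\<close>, so the factor with
    index \<open>L - 1\<close> vanishes; it is present as soon as \<open>L <= N\<close>.\<close>
  have T_below: "T N (j - int L) = 0" if "0 < L" "L \<le> N" for N L
  proof -
    have "1 - p * y (j - int L) * p ^ (L - 1) = 0"
      using p that by (simp add: y_below power_one_over flip: power_Suc)
    moreover have "L - 1 < N" using that by simp
    ultimately have "qpoch (p * y (j - int L)) p N = 0"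
      unfolding qpoch_def by (intro prod_zero) auto
    then show ?thesis by (simp add: T_def)
  qed
  \<comment> \<open>Both the power of \<open>y\<close> and the product are at most
    \<open>(1 / p) ^ (L * N)\<close>. Using \<open>N < L\<close> makes the final bound independent
    of \<open>N\<close>, as dominated convergence requires.\<close>
  have T_far: "\<bar>T N (j - int L)\<bar> \<le> (1 / q) ^ (4 * L\<^sup>2)" if "N < L" for N L
  proof -
    have ip: "1 / p \<ge> 1" using p by simp
    have "\<bar>qpoch (p * y (j - int L)) p N\<bar> \<le> (\<Prod>i<N. (1 / p) ^ L)"
      unfolding qpoch_def abs_prod
    proof (rule prod_mono)
      fix i assume "i \<in> {..<N}"
      have "p * y (j - int L) * p ^ i = p ^ Suc i * (1 / p) ^ L"
        by (simp add: y_below)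
      moreover have "p ^ Suc i * (1 / p) ^ L \<le> (1 / p) ^ L"
        using p by (intro mult_left_le_one_le power_le_one) auto
      moreover have "1 \<le> (1 / p) ^ L" using ip by (rule one_le_power)
      moreover have "0 \<le> p ^ Suc i * (1 / p) ^ L" using p by simp
      ultimately show "0 \<le> \<bar>1 - p * y (j - int L) * p ^ i\<bar> \<and>
          \<bar>1 - p * y (j - int L) * p ^ i\<bar> \<le> (1 / p) ^ L"
        by linarith
    qed
    then have "\<bar>T N (j - int L)\<bar> \<le> ((1 / p) ^ L) ^ N * ((1 / p) ^ L) ^ N"
      unfolding T_def abs_mult y_below using p by (intro mult_mono) auto
    also have "\<dots> = (1 / p) ^ (2 * (L * N))"
      by (simp add: mult_2 power_add flip: power_mult)
    also have "\<dots> \<le> (1 / p) ^ (2 * L\<^sup>2)"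
      using that ip by (intro power_increasing) (auto simp: power2_eq_square)
    also have "\<dots> = (1 / q) ^ (4 * L\<^sup>2)"
      by (simp add: p_def power_divide flip: power_mult)
    finally show ?thesis .
  qed
  have T_bound: "\<bar>w k * T N k\<bar> \<le> G k" for N k
  proof -
    have one: "1 \<le> K * (1 / q) ^ (8 * (nat (- k))\<^sup>2)"
      using mult_mono[OF K1 one_le_power[of "1 / q" "8 * (nat (- k))\<^sup>2"]] q K1 by simp
    have "\<bar>T N k\<bar> \<le> K * (1 / q) ^ (8 * (nat (- k))\<^sup>2)"
    proof (cases "k \<ge> j")
      case True
      then obtain l where l: "k = j + int l" using zle_iff_zadd by auto
      have "\<bar>T N k\<bar> \<le> 1"
        using T_ge[OF True, of N] y_le[OF l] p power_le_one[of "y k" N] power_le_one[of p l]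
        by simp
      with one show ?thesis by simp
    next
      case False
      then obtain L where "j = k + int L"
        using zle_iff_zadd[of k j] by auto
      with False have L: "k = j - int L" "L > 0" by auto
      show ?thesis
      proof (cases "L \<le> N")
        case True
        then show ?thesis using T_below[OF L(2)] L one by simp
      next
        case False
        have "L \<le> nat \<bar>j\<bar> + nat (- k)" using L by linarith
        then have "L\<^sup>2 \<le> (nat \<bar>j\<bar> + nat (- k))\<^sup>2" by simp
        also have "\<dots> \<le> 2 * (nat \<bar>j\<bar>)\<^sup>2 + 2 * (nat (- k))\<^sup>2"
        proof -
          have "0 \<le> (int (nat \<bar>j\<bar>) - int (nat (- k)))\<^sup>2" by simp
          then have "int ((nat \<bar>j\<bar> + nat (- k))\<^sup>2) \<le> int (2 * (nat \<bar>j\<bar>)\<^sup>2 + 2 * (nat (- k))\<^sup>2)"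
            unfolding of_nat_power of_nat_add of_nat_mult by (simp add: power2_eq_square algebra_simps)
          then show ?thesis by linarith
        qed
        finally have "(1 / q) ^ (4 * L\<^sup>2) \<le> (1 / q) ^ (8 * (nat \<bar>j\<bar>)\<^sup>2 + 8 * (nat (- k))\<^sup>2)"
          using q by (intro power_increasing) auto
        then show ?thesis
          using T_far[of N L] False L by (simp add: K_def power_add)
      qed
    qed
    then show ?thesis
      unfolding G_def abs_mult
      using mult_left_mono[of "\<bar>T N k\<bar>" "K * (1 / q) ^ (8 * (nat (- k))\<^sup>2)" "\<bar>w k\<bar>"]
      by (simp add: mult_ac)
  qed
  \<comment> \<open>At \<open>k = j\<close> one has \<open>y = 1\<close> and only the product
    remains. For \<open>k > j\<close> the powers of \<open>y < 1\<close> tend to 0, and for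
    \<open>k < j\<close> the terms are eventually exactly 0.\<close>
  have T_lim: "(\<lambda>N. w k * T N k) \<longlonglongrightarrow> (if k = j then w j * qpoch_inf p p else 0)" for k
  proof -
    consider "k = j" | "k > j" | "k < j" by linarith
    then show ?thesis
    proof cases
      case 1
      have "(\<lambda>N. w j * qpoch p p N) \<longlonglongrightarrow> w j * qpoch_inf p p"
        using p by (intro tendsto_intros qpoch_LIMSEQ) auto
      then show ?thesis using 1 by (simp add: T_def y_def)
    next
      case 2
      then obtain l where "k = j + int l"
        using zle_iff_zadd[of j k] by auto
      with 2 have l: "k = j + int l" "l > 0" by auto
      have "0 \<le> y k" "y k < 1"
        using y_le[OF l(1)] p l(2) by (auto simp: power_less_one_iff)
      then have "(\<lambda>N. y k ^ N) \<longlonglongrightarrow> 0" by (simp add: LIMSEQ_power_zero)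
      then have "(\<lambda>N. T N k) \<longlonglongrightarrow> 0"
        by (rule Lim_null_comparison[rotated]) (use T_ge[of k] 2 in simp)
      from tendsto_mult_right_zero[OF this, of "w k"] show ?thesis using 2 by simp
    next
      case 3
      then obtain L where "j = k + int L"
        using zle_iff_zadd[of k j] by auto
      with 3 have L: "k = j - int L" "L > 0" by auto
      have "\<forall>\<^sub>F N in sequentially. w k * T N k = 0"
        using eventually_ge_at_top[of L] by eventually_elim (simp add: L T_below)
      then show ?thesis using 3 by (simp add: tendsto_eventually)
    qed
  qed

  \<comment> \<open>An enumeration of the integers turns the lattice sums into ordinary series, to
    which Tannery's theorem applies with majorant \<open>G\<close>.\<close>
  have bij: "bij_betw int_decode UNIV UNIV" by (rule bij_int_decode)
  have "summable (\<lambda>n. G (int_decode n))"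
  proof (rule summable_on_imp_summable)
    have "G summable_on UNIV"
      unfolding G_def by (intro summable_on_cmult_right rapid_bound_summable w)
    then show "(\<lambda>n. G (int_decode n)) summable_on UNIV"
      using summable_on_reindex_bij_betw[OF bij, of G] by simp
  qed
  then have "(\<lambda>N. \<Sum>n. w (int_decode n) * T N (int_decode n)) \<longlonglongrightarrow>
      (\<Sum>n. if int_decode n = j then w j * qpoch_inf p p else 0)"
    using T_bound T_lim
    by (intro conjunct2[OF conjunct2[OF tannerys_theorem[where M = "\<lambda>n. G (int_decode n)"]]])
      (auto simp: case_prod_unfold)
  moreover have "(\<Sum>n. w (int_decode n) * T N (int_decode n)) = 0" for N
  proof -
    have "((\<lambda>n. w (int_decode n) * T N (int_decode n)) has_sum 0) UNIV"
      using T_sum[of N] has_sum_reindex_bij_betw[OF bij, of "\<lambda>k. w k * T N k" 0] by simp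
    then show ?thesis using has_sum_imp_sums sums_unique by metis
  qed
  moreover have "(\<Sum>n. if int_decode n = j then w j * qpoch_inf p p else 0) = w j * qpoch_inf p p"
  proof -
    have "int_decode n = j \<longleftrightarrow> n = int_encode j" for n
      by (metis int_decode_inverse int_encode_inverse)
    then show ?thesis
      using sums_unique[OF sums_single[of "int_encode j" "\<lambda>_. w j * qpoch_inf p p"]] by simp
  qed
  ultimately have "w j * qpoch_inf p p = 0"
    by (simp add: LIMSEQ_const_iff)
  then show ?thesis
    using qpoch_inf_nonzero[of p p] p by simp
qed

section \<open>Power series with Gaussian-type coefficients\<close>

text \<open>The quadratic exponent of \<open>p\<close> wins against the geometric factor and against
  \<open>fact (4 * n) <= (4 * n) ^ (4 * n)\<close>, whose logarithm is of order
  \<open>n * ln n\<close>. The factorial is there for comparison with the exponential series in the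
  next lemma.\<close>

lemma superexponential_bounded:
  fixes p R :: real
  assumes "0 < p" "p < 1"
  shows "\<exists>K. \<forall>n. R ^ n * p ^ (n\<^sup>2) * fact (4 * n) \<le> K"
proof -
  define B where "B = max \<bar>R\<bar> 1"
  define l where "l = - ln p"
  have l: "l > 0" "p = exp (- l)" using assms by (auto simp: l_def)
  have B: "B > 0" by (simp add: B_def)
  define L where "L = ln B"
  define g where "g n = exp (real n * L - l * real n ^ 2 + 4 * real n * ln (4 * real n))" for n
  have "g \<longlonglongrightarrow> 0" unfolding g_def using l(1) by real_asymp
  then obtain K where K: "\<And>n. norm (g n) \<le> K"
    by (rule BseqE[OF convergent_imp_Bseq[OF convergentI]]) blast
  have "R ^ n * p ^ (n\<^sup>2) * fact (4 * n) \<le> g n" for n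
  proof -
    have "R ^ n \<le> B ^ n"
    proof -
      have "R ^ n \<le> \<bar>R\<bar> ^ n" unfolding power_abs[symmetric] by (rule abs_ge_self)
      also have "\<dots> \<le> B ^ n" by (intro power_mono) (auto simp: B_def)
      finally show ?thesis .
    qed
    moreover have "(fact (4 * n) :: real) \<le> (4 * real n) ^ (4 * n)"
      using fact_le_power[of "4 * n", where 'a = real] by simp
    ultimately have "R ^ n * p ^ (n\<^sup>2) * fact (4 * n) \<le> B ^ n * p ^ (n\<^sup>2) * (4 * real n) ^ (4 * n)"
      using assms B by (intro mult_mono mult_right_mono) auto
    also have "\<dots> = g n"
    proof (cases "n = 0")
      case False
      have "B ^ n = exp (real n * L)"
        using B by (simp add: L_def exp_of_nat_mult)
      moreover have "p ^ (n\<^sup>2) = exp (- (l * real n ^ 2))"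
        using exp_of_nat_mult[of "n\<^sup>2" "- l"] by (simp add: l(2) mult.commute)
      moreover have "(4 * real n) ^ (4 * n) = exp (4 * real n * ln (4 * real n))"
        using False exp_of_nat_mult[of "4 * n" "ln (4 * real n)"] by simp
      ultimately show ?thesis
        unfolding g_def diff_conv_add_uminus exp_add by simp
    qed (simp add: g_def)
    finally show ?thesis .
  qed
  then show ?thesis
    using K order_trans[OF _ order_trans[OF abs_ge_self]] unfolding real_norm_def by blast
qed

text \<open>With \<open>x = \<delta> * sqrt r\<close> one has
  \<open>x ^ (4 * n) = \<delta> ^ (4 * n) * r ^ (2 * n)\<close>. So each term is a bounded multiple
  of \<open>x ^ (4 * n) / fact (4 * n)\<close>, and these are every fourth term of the series of
  \<open>exp x\<close>.\<close>

lemma superexponential_growth: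
  fixes p R :: real
  assumes p: "0 < p" "p < 1" and \<delta>: "\<delta> > 0" and R: "R \<ge> 0"
  shows "\<exists>K. \<forall>r\<ge>0. summable (\<lambda>n. R ^ n * p ^ (n\<^sup>2) * r ^ (2 * n)) \<and>
           (\<Sum>n. R ^ n * p ^ (n\<^sup>2) * r ^ (2 * n)) \<le> K * exp (\<delta> * sqrt r)"
proof -
  obtain K where K: "\<And>n. (R / \<delta> ^ 4) ^ n * p ^ (n\<^sup>2) * fact (4 * n) \<le> K"
    using superexponential_bounded[OF p] by blast
  have K0: "K \<ge> 0" using K[of 0] by simp
  show ?thesis
  proof (intro exI[of _ K] allI impI)
    fix r :: real assume r: "r \<ge> 0"
    define x where "x = \<delta> * sqrt r"
    have x: "x \<ge> 0" using \<delta> r by (simp add: x_def)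
    have x4: "x ^ (4 * n) = (\<delta> ^ 4) ^ n * r ^ (2 * n)" for n
    proof -
      have "x ^ 4 = \<delta> ^ 4 * r ^ 2"
        using r power_mult[of "sqrt r" 2 2] by (simp add: x_def power_mult_distrib)
      then show ?thesis by (simp only: power_mult power_mult_distrib)
    qed
    have e: "(\<lambda>n. x ^ n / fact n) sums exp x"
      using exp_converges[of x] by (simp add: scaleR_conv_of_real divide_inverse mult.commute)
    have s4: "summable (\<lambda>n. x ^ (4 * n) / fact (4 * n))"
      using summable_reindex[of "\<lambda>n. x ^ n / fact n" "\<lambda>n. 4 * n"] e x
      by (auto simp: o_def sums_iff inj_on_def)
    have le4: "(\<Sum>n. x ^ (4 * n) / fact (4 * n)) \<le> exp x"
      using suminf_reindex_mono[of "\<lambda>n. x ^ n / fact n" "\<lambda>n. 4 * n"] e x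
      by (auto simp: o_def sums_iff inj_on_def)
    have bound: "R ^ n * p ^ (n\<^sup>2) * r ^ (2 * n) \<le> K * (x ^ (4 * n) / fact (4 * n))" for n
    proof -
      have "R ^ n * p ^ (n\<^sup>2) * r ^ (2 * n) =
          ((R / \<delta> ^ 4) ^ n * p ^ (n\<^sup>2) * fact (4 * n)) * (x ^ (4 * n) / fact (4 * n))"
        using \<delta> by (simp add: x4 power_divide)
      also have "\<dots> \<le> K * (x ^ (4 * n) / fact (4 * n))"
        using K[of n] x by (intro mult_right_mono) auto
      finally show ?thesis .
    qed
    have s: "summable (\<lambda>n. R ^ n * p ^ (n\<^sup>2) * r ^ (2 * n))"
      by (rule summable_comparison_test[OF _ summable_mult[OF s4, of K]])
        (use bound R p r in auto)
    have "(\<Sum>n. R ^ n * p ^ (n\<^sup>2) * r ^ (2 * n)) \<le> (\<Sum>n. K * (x ^ (4 * n) / fact (4 * n)))"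
      using bound s s4 by (intro suminf_le summable_mult)
    also have "\<dots> \<le> K * exp x"
      unfolding suminf_mult[OF s4] using le4 K0 by (rule mult_left_mono)
    finally show "summable (\<lambda>n. R ^ n * p ^ (n\<^sup>2) * r ^ (2 * n)) \<and>
        (\<Sum>n. R ^ n * p ^ (n\<^sup>2) * r ^ (2 * n)) \<le> K * exp (\<delta> * sqrt r)"
      using s by (simp add: x_def)
  qed
qed

text \<open>The series is a power series in \<open>u = z^2\<close>. Holomorphy passes from
  \<open>u\<close> to \<open>z\<close> by composition with squaring, while \<open>csqrt\<close>
  carries convergence and vanishing from \<open>z\<close> back to \<open>u\<close>.\<close>

lemma even_power_series_entire:
  fixes b :: "nat \<Rightarrow> complex"
  assumes p: "0 < p" "p < 1" and R: "R \<ge> 0" and W: "W \<ge> 0"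
    and b: "\<And>n. norm (b n) \<le> W * (R ^ n * p ^ (n\<^sup>2))"
  shows "(\<lambda>z. \<Sum>n. b n * z ^ (2 * n)) holomorphic_on UNIV"
    and "\<delta> > 0 \<Longrightarrow>
      \<exists>K. \<forall>z. norm (\<Sum>n. b n * z ^ (2 * n)) \<le> K * exp (\<delta> * sqrt (norm z))"
    and "(\<And>z. (\<Sum>n. b n * z ^ (2 * n)) = 0) \<Longrightarrow> b m = 0"
proof -
  have le: "norm (b n * z ^ (2 * n)) \<le> W * (R ^ n * p ^ (n\<^sup>2) * norm z ^ (2 * n))" for n z
    using mult_right_mono[OF b[of n], of "norm z ^ (2 * n)"]
    by (simp only: norm_mult norm_power mult.assoc zero_le_power norm_ge_zero)
  have s: "summable (\<lambda>n. R ^ n * p ^ (n\<^sup>2) * r ^ (2 * n))" if "r \<ge> 0" for r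
    using superexponential_growth[OF p zero_less_one R] that by blast
  have sn: "summable (\<lambda>n. norm (b n * z ^ (2 * n)))" for z
    by (rule summable_comparison_test[OF _ summable_mult[OF s[of "norm z"], of W]]) (use le in auto)
  have pow: "(\<lambda>n. b n * u ^ n) sums (\<Sum>n. b n * u ^ n)" for u
    using summable_norm_cancel[OF sn[of "csqrt u"]] by (simp add: power_mult summable_sums)
  have "(\<lambda>u. \<Sum>n. b n * u ^ n) holomorphic_on ball 0 r" for r
    by (rule power_series_holomorphic[where a = b]) (use pow in simp)
  then have "(\<lambda>u. \<Sum>n. b n * u ^ n) holomorphic_on (\<Union>r. ball 0 r)"
    by (intro holomorphic_on_UN_open) auto
  moreover have "z \<in> (\<Union>r. ball 0 r)" for z :: complex
    by (rule UN_I[of "norm z + 1"]) auto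
  then have "(\<Union>r. ball 0 r) = (UNIV :: complex set)" by blast
  ultimately have H: "(\<lambda>u. \<Sum>n. b n * u ^ n) holomorphic_on UNIV" by simp
  have "(\<lambda>u. \<Sum>n. b n * u ^ n) \<circ> (\<lambda>z. z\<^sup>2) holomorphic_on UNIV"
    by (rule holomorphic_on_compose_gen[OF _ H]) (auto intro: holomorphic_intros)
  then show "(\<lambda>z. \<Sum>n. b n * z ^ (2 * n)) holomorphic_on UNIV" by (simp add: o_def power_mult)
  show "\<exists>K. \<forall>z. norm (\<Sum>n. b n * z ^ (2 * n)) \<le> K * exp (\<delta> * sqrt (norm z))" if \<delta>: "\<delta> > 0"
  proof -
    obtain K where K: "\<And>r. r \<ge> 0 \<Longrightarrow> (\<Sum>n. R ^ n * p ^ (n\<^sup>2) * r ^ (2 * n)) \<le> K * exp (\<delta> * sqrt r)"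
      using superexponential_growth[OF p \<delta> R] by blast
    have "norm (\<Sum>n. b n * z ^ (2 * n)) \<le> (W * K) * exp (\<delta> * sqrt (norm z))" for z
    proof -
      have "norm (\<Sum>n. b n * z ^ (2 * n)) \<le> (\<Sum>n. norm (b n * z ^ (2 * n)))"
        by (rule summable_norm[OF sn])
      also have "\<dots> \<le> (\<Sum>n. W * (R ^ n * p ^ (n\<^sup>2) * norm z ^ (2 * n)))"
        by (intro suminf_le le sn summable_mult s) simp
      also have "\<dots> = W * (\<Sum>n. R ^ n * p ^ (n\<^sup>2) * norm z ^ (2 * n))"
        by (intro suminf_mult s) simp
      also have "\<dots> \<le> W * (K * exp (\<delta> * sqrt (norm z)))"
        using K W by (intro mult_left_mono) auto
      finally show ?thesis by (simp add: mult.assoc)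
    qed
    then show ?thesis by blast
  qed
  show "b m = 0" if "\<And>z. (\<Sum>n. b n * z ^ (2 * n)) = 0"
  proof -
    have z: "(\<Sum>n. b n * u ^ n) = 0" for u
      using that[of "csqrt u"] by (simp add: power_mult)
    show ?thesis
    proof (rule ccontr)
      assume nz: "b m \<noteq> 0"
      \<comment> \<open>The theorem on isolated zeros needs a nonzero coefficient of positive index,
        so index 0 is excluded first. It then yields a punctured disc on which the zero function
        would not vanish.\<close>
      have "b 0 = 0" using z[of 0] unfolding powser_zero .
      with nz have "m \<noteq> 0" by metis
      then obtain s :: real where "0 < s" "\<And>u. u \<in> cball 0 s - {0} \<Longrightarrow> (\<lambda>_::complex. 0::complex) u \<noteq> 0"
        using powser_0_nonzero[of 1 0 b "\<lambda>_. 0" m] pow nz unfolding z by auto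
      from this(2)[of "of_real s"] this(1) show False by simp
    qed
  qed
qed

text \<open>This justifies exchanging the lattice sum with the Bessel series. By
  \<open>lattice_power_le\<close> the terms are dominated by a product \<open>G k * H n\<close>,
  since \<open>q ^ (n^2)\<close> times \<open>(1 / sqrt q) ^ (n^2)\<close> still leaves
  \<open>sqrt q ^ (n^2)\<close>.\<close>

lemma rapid_double_sum:
  fixes c :: "nat \<Rightarrow> real" and z :: complex
  assumes q: "0 < q" "q < 1" and w: "rapid q w" and R: "R \<ge> 0"
    and c: "\<And>n. \<bar>c n\<bar> \<le> R ^ n * q ^ (n\<^sup>2)"
  defines "t \<equiv> \<lambda>k n. of_real (w k) * (of_real (c n) * (z * of_real (q powi k)) ^ (2 * n))"
  shows "(\<lambda>(k, n). norm (t k n)) summable_on UNIV \<times> UNIV"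
proof -
  define p where "p = sqrt q"
  have p: "0 < p" "p < 1" "q = p\<^sup>2" using q by (auto simp: p_def)
  define G where "G k = \<bar>w k\<bar> * (1 / q) ^ (2 * (nat (- k))\<^sup>2)" for k
  define H where "H n = R ^ n * p ^ (n\<^sup>2) * norm z ^ (2 * n)" for n
  have G: "G summable_on UNIV"
    unfolding G_def by (rule rapid_bound_summable[OF w])
  have "summable H"
    unfolding H_def using superexponential_growth[OF p(1,2) zero_less_one R] norm_ge_zero by blast
  then have H: "H summable_on UNIV"
    using R p by (subst summable_on_UNIV_nonneg_real_iff) (auto simp: H_def)
  have "(\<lambda>(k, n). G k * H n) summable_on UNIV \<times> UNIV"
  proof (rule summable_on_SigmaI[where g = "\<lambda>k. G k * infsum H UNIV"])
    show "((\<lambda>n. case (k, n) of (k, n) \<Rightarrow> G k * H n) has_sum G k * infsum H UNIV) UNIV" for k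
      using has_sum_cmult_right[OF has_sum_infsum[OF H], of "G k"] by simp
    show "(\<lambda>k. G k * infsum H UNIV) summable_on UNIV"
      by (rule summable_on_cmult_left[OF G])
    show "0 \<le> (case (k, n) of (k, n) \<Rightarrow> G k * H n)" for k n
      using R p q by (simp add: G_def H_def)
  qed
  then show ?thesis
  proof (rule summable_on_comparison_test)
    fix kn :: "int \<times> nat"
    obtain k n where kn: "kn = (k, n)" by fastforce
    have "norm (t k n) = \<bar>w k\<bar> * \<bar>c n\<bar> * (q powi k) ^ (2 * n) * norm z ^ (2 * n)"
      using q by (simp add: t_def norm_mult norm_power norm_power_int power_mult_distrib mult_ac)
    also have "\<dots> \<le> \<bar>w k\<bar> * (R ^ n * q ^ (n\<^sup>2)) *
        ((1 / p) ^ (n\<^sup>2) * (1 / q) ^ (2 * (nat (- k))\<^sup>2)) * norm z ^ (2 * n)"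
      using lattice_power_le[OF q, of k n] c[of n] q R unfolding p_def
      by (intro mult_mono mult_right_mono mult_left_mono) auto
    also have "\<dots> = G k * H n"
    proof -
      have "q ^ (n\<^sup>2) * (1 / p) ^ (n\<^sup>2) = p ^ (n\<^sup>2)"
        unfolding power_mult_distrib[symmetric] using p by (simp add: power2_eq_square)
      then have "G k * H n = \<bar>w k\<bar> * (1 / q) ^ (2 * (nat (- k))\<^sup>2) *
          (R ^ n * (q ^ (n\<^sup>2) * (1 / p) ^ (n\<^sup>2)) * norm z ^ (2 * n))"
        by (simp add: G_def H_def)
      then show ?thesis by (simp add: mult_ac)
    qed
    finally show "(case kn of (k, n) \<Rightarrow> norm (t k n)) \<le> (case kn of (k, n) \<Rightarrow> G k * H n)"
      by (simp add: kn)
  qed auto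
qed

lemma rapid_moment_bound:
  assumes q: "0 < q" "q < 1" and w: "rapid q w"
  shows "\<bar>\<Sum>\<^sub>\<infinity>k. w k * (q powi k) ^ (2 * n)\<bar> \<le>
    (1 / sqrt q) ^ (n\<^sup>2) * (\<Sum>\<^sub>\<infinity>k. \<bar>w k\<bar> * (1 / q) ^ (2 * (nat (- k))\<^sup>2))"
proof -
  let ?G = "\<lambda>k. \<bar>w k\<bar> * (1 / q) ^ (2 * (nat (- k))\<^sup>2)"
  have G: "(\<lambda>k. (1 / sqrt q) ^ (n\<^sup>2) * ?G k) summable_on UNIV"
    by (intro summable_on_cmult_right rapid_bound_summable w)
  note s = rapid_moment_abs_summable[OF q w, of n]
  have "\<bar>\<Sum>\<^sub>\<infinity>k. w k * (q powi k) ^ (2 * n)\<bar> \<le> (\<Sum>\<^sub>\<infinity>k. norm (w k * (q powi k) ^ (2 * n)))"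
    using norm_infsum_bound[OF s] by simp
  also have "\<dots> \<le> (\<Sum>\<^sub>\<infinity>k. (1 / sqrt q) ^ (n\<^sup>2) * ?G k)"
    using s G rapid_moment_le[OF q] by (rule infsum_mono)
  finally show ?thesis by (simp add: infsum_cmult_right')
qed

section \<open>The q-Bessel transform\<close>

definition qbessel_coeff :: "real \<Rightarrow> real \<Rightarrow> nat \<Rightarrow> real" where
  "qbessel_coeff q \<nu> n = (-1) ^ n * q ^ (n * (n + 1)) /
     (qpoch (q powr (2 * \<nu> + 2)) (q\<^sup>2) n * qpoch (q\<^sup>2) (q\<^sup>2) n)"

text \<open>The Jackson mass \<open>q powi k\<close> is absorbed, so up to the factor
  \<open>1 - q\<close> integrating against \<open>f t * t powr (2 * \<nu> + 1)\<close> is summing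
  against this weight.\<close>

definition lattice_weight :: "real \<Rightarrow> real \<Rightarrow> (real \<Rightarrow> real) \<Rightarrow> int \<Rightarrow> real" where
  "lattice_weight q \<nu> f k = q powi k * f (q powi k) * (q powi k) powr (2 * \<nu> + 1)"

lemma qbessel_power_series: "qbessel q \<nu> x = (\<Sum>n. of_real (qbessel_coeff q \<nu> n) * x ^ (2 * n))"
  by (simp add: qbessel_def qbessel_coeff_def)

lemma qpoch_ge:
  fixes a p :: real
  assumes "0 \<le> a" "a < 1" "0 \<le> p" "p \<le> 1"
  shows "(1 - a) ^ n \<le> qpoch a p n"
proof -
  have "(\<Prod>k<n. 1 - a) \<le> (\<Prod>k<n. 1 - a * p ^ k)"
    using assms by (intro prod_mono) (auto intro: mult_left_le power_le_one)
  then show ?thesis by (simp add: qpoch_def)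
qed

context
  fixes q \<nu> :: real
  assumes q: "0 < q" "q < 1" and \<nu>: "\<nu> > -1"
begin

lemma base_less_1: "0 < q powr (2 * \<nu> + 2)" "q powr (2 * \<nu> + 2) < 1" "q\<^sup>2 < 1"
  using q \<nu> powr_less_mono2[of "2 * \<nu> + 2" q 1] by (auto simp: power_less_one_iff)

lemma qpoch_pos: "0 < qpoch (q powr (2 * \<nu> + 2)) (q\<^sup>2) n" "0 < qpoch (q\<^sup>2) (q\<^sup>2) n"
  using qpoch_ge[of "q powr (2 * \<nu> + 2)" "q\<^sup>2" n] qpoch_ge[of "q\<^sup>2" "q\<^sup>2" n] base_less_1 q
  by (auto intro: less_le_trans[rotated] zero_less_power)

lemma qbessel_coeff_nonzero: "qbessel_coeff q \<nu> n \<noteq> 0"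
  using q qpoch_pos[of n] by (simp add: qbessel_coeff_def)

text \<open>Each factor of the two denominators is at least its first one, so they cost only a
  geometric factor, and \<open>n * (n + 1) >= n^2\<close>.\<close>

lemma qbessel_coeff_bound:
  obtains R where "R \<ge> 0" "\<And>n. \<bar>qbessel_coeff q \<nu> n\<bar> \<le> R ^ n * q ^ (n\<^sup>2)"
proof
  let ?R = "1 / ((1 - q powr (2 * \<nu> + 2)) * (1 - q\<^sup>2))"
  show "?R \<ge> 0" using base_less_1 by simp
  fix n
  let ?d = "qpoch (q powr (2 * \<nu> + 2)) (q\<^sup>2) n * qpoch (q\<^sup>2) (q\<^sup>2) n"
  have d: "((1 - q powr (2 * \<nu> + 2)) * (1 - q\<^sup>2)) ^ n \<le> ?d"
    unfolding power_mult_distrib using base_less_1 q qpoch_pos[of n]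
    by (intro mult_mono qpoch_ge) auto
  have "\<bar>qbessel_coeff q \<nu> n\<bar> = q ^ (n * (n + 1)) / ?d"
    using q qpoch_pos[of n] by (simp add: qbessel_coeff_def abs_mult power_abs)
  also have "\<dots> \<le> q ^ (n\<^sup>2) / ((1 - q powr (2 * \<nu> + 2)) * (1 - q\<^sup>2)) ^ n"
    using base_less_1 q d by (intro frac_le power_decreasing) (auto simp: power2_eq_square)
  also have "\<dots> = ?R ^ n * q ^ (n\<^sup>2)"
    by (simp add: power_one_over)
  finally show "\<bar>qbessel_coeff q \<nu> n\<bar> \<le> ?R ^ n * q ^ (n\<^sup>2)" .
qed

lemma cq_nonzero: "cq q \<nu> \<noteq> 0"
  using base_less_1 q qpoch_inf_nonzero[of "q powr (2 * \<nu> + 2)" "q\<^sup>2"] qpoch_inf_nonzero[of "q\<^sup>2" "q\<^sup>2"]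
  by (simp add: cq_def)

text \<open>The Jackson mass raises the exponent \<open>2 * \<nu> + 1\<close> to
  \<open>2 * \<nu> + 2\<close>, which is positive since \<open>\<nu> > -1\<close>.\<close>

lemma rapid_lattice_weight:
  assumes "\<forall>x \<in> qlattice q. \<bar>f x\<bar> \<le> C * exp (- (1 / 2) * x\<^sup>2)"
  shows "rapid q (lattice_weight q \<nu> f)"
proof (rule rapid_if_gaussian_bound[where \<beta> = "2 * \<nu> + 2" and C = C])
  fix k
  have pos: "q powi k > 0" using q by simp
  have "\<bar>f (q powi k)\<bar> \<le> C * exp (- (1 / 2) * (q powi k)\<^sup>2)"
    using assms by (auto simp: qlattice_def)
  then have "(q powi k) powr (2 * \<nu> + 2) * \<bar>f (q powi k)\<bar> \<le>
      (q powi k) powr (2 * \<nu> + 2) * (C * exp (- (1 / 2) * (q powi k)\<^sup>2))"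
    by (rule mult_left_mono) simp
  moreover have "(q powi k) powr (2 * \<nu> + 2) = q powi k * (q powi k) powr (2 * \<nu> + 1)"
    using pos powr_add[of "q powi k" 1 "2 * \<nu> + 1"] by (simp add: add.commute)
  ultimately show "\<bar>lattice_weight q \<nu> f k\<bar> \<le>
      C * (q powi k) powr (2 * \<nu> + 2) * exp (- (1 / 2) * (q powi k)\<^sup>2)"
    using pos by (simp add: lattice_weight_def abs_mult mult_ac)
qed (use q \<nu> in auto)

text \<open>Both facts come from one absolutely summable double family \<open>t k n\<close>. Its row
  sums are the integrand at \<open>q powi k\<close> times the Jackson mass; its column sums are the
  terms of the power series, with the even moments of the weight as factors.\<close>

lemma
  assumes w: "rapid q (lattice_weight q \<nu> f)"
  shows jackson_integrable_qbessel_integrand: "jackson_integrable q (qbessel_integrand q \<nu> f z)"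
    and qbessel_transform_power_series: "qbessel_transform q \<nu> f z =
      (\<Sum>n. of_real (cq q \<nu> * (1 - q) * qbessel_coeff q \<nu> n *
        (\<Sum>\<^sub>\<infinity>k. lattice_weight q \<nu> f k * (q powi k) ^ (2 * n))) * z ^ (2 * n))"
proof -
  define w where "w = lattice_weight q \<nu> f"
  define c where "c = qbessel_coeff q \<nu>"
  define t where "t k n = complex_of_real (w k) *
    (of_real (c n) * (z * of_real (q powi k)) ^ (2 * n))" for k n
  obtain R where R: "R \<ge> 0" "\<And>n. \<bar>c n\<bar> \<le> R ^ n * q ^ (n\<^sup>2)"
    using qbessel_coeff_bound unfolding c_def by blast
  have abs: "(\<lambda>(k, n). norm (t k n)) summable_on UNIV \<times> UNIV"
    unfolding t_def w_def by (rule rapid_double_sum[OF q w R])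
  have sum: "(\<lambda>(k, n). t k n) summable_on UNIV \<times> UNIV"
    by (rule abs_summable_summable) (use abs in \<open>simp only: case_prod_unfold\<close>)
  have row_abs: "(\<lambda>n. norm (t k n)) summable_on UNIV" for k
    using summable_on_SigmaD1[OF abs, of k] by simp
  have row: "(\<Sum>\<^sub>\<infinity>n. t k n) =
      of_real (q powi k) * qbessel_integrand q \<nu> f z (q powi k)" for k
  proof -
    have "(\<Sum>\<^sub>\<infinity>n. t k n) = (\<Sum>n. t k n)"
      using row_abs[of k] by (intro infsumI norm_summable_imp_has_sum)
        (auto intro: summable_on_imp_summable summable_norm_cancel summable_sums)
    also have "\<dots> = of_real (w k) * qbessel q \<nu> (z * of_real (q powi k))"
    \<comment> \<open>Convergence of the Bessel series is obtained by cancelling \<open>w k\<close>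
      from the summable row; when \<open>w k = 0\<close> both sides are 0.\<close>
    proof (cases "w k = 0")
      case False
      have "summable (\<lambda>n. t k n)"
        using row_abs[of k] by (intro summable_norm_cancel[OF summable_on_imp_summable])
      then have "summable (\<lambda>n. of_real (c n) * (z * of_real (q powi k)) ^ (2 * n))"
        using False unfolding t_def by (simp add: summable_mult_D)
      then show ?thesis
        unfolding t_def qbessel_power_series c_def[symmetric] by (rule suminf_mult)
    qed (simp add: t_def)
    finally show ?thesis
      by (simp add: w_def lattice_weight_def qbessel_integrand_def mult_ac)
  qed
  have "(\<lambda>k. \<Sum>\<^sub>\<infinity>n. norm (t k n)) summable_on UNIV"
    using summable_on_Sigma_banach[of "\<lambda>k n. norm (t k n)" UNIV "\<lambda>_. UNIV"] abs by simp
  then have "(\<lambda>k. norm (\<Sum>\<^sub>\<infinity>n. t k n)) summable_on UNIV"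
    by (rule Infinite_Sum.abs_summable_on_comparison_test') (rule norm_infsum_bound[OF row_abs])
  then show "jackson_integrable q (qbessel_integrand q \<nu> f z)"
    using q by (simp add: jackson_integrable_def row norm_mult norm_power_int)
  define \<mu> where "\<mu> n = (\<Sum>\<^sub>\<infinity>k. w k * (q powi k) ^ (2 * n))" for n
  have col: "(\<Sum>\<^sub>\<infinity>k. t k n) = of_real (c n * \<mu> n) * z ^ (2 * n)" for n
  proof -
    have moment: "((\<lambda>k. complex_of_real (w k * (q powi k) ^ (2 * n))) has_sum of_real (\<mu> n)) UNIV"
      unfolding \<mu>_def w_def
      by (rule has_sum_of_real[OF has_sum_infsum[OF abs_summable_summable[
              OF rapid_moment_abs_summable[OF q w]]]])
    have "(\<Sum>\<^sub>\<infinity>k. t k n) = (\<Sum>\<^sub>\<infinity>k. (of_real (c n) * z ^ (2 * n)) * of_real (w k * (q powi k) ^ (2 * n)))"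
      by (intro infsum_cong) (simp add: t_def power_mult_distrib mult_ac)
    also have "\<dots> = (of_real (c n) * z ^ (2 * n)) * of_real (\<mu> n)"
      unfolding infsum_cmult_right' by (simp only: infsumI[OF moment])
    finally show ?thesis by (simp add: mult_ac)
  qed
  have sum': "(\<lambda>(n, k). t k n) summable_on UNIV \<times> UNIV"
    using iffD1[OF summable_on_swap sum] by simp
  have cols: "(\<lambda>n. of_real (c n * \<mu> n) * z ^ (2 * n)) summable_on UNIV"
    using summable_on_Sigma_banach[of "\<lambda>n k. t k n" UNIV "\<lambda>_. UNIV"] sum' by (simp add: col)
  have "jackson_integral q (qbessel_integrand q \<nu> f z) = of_real (1 - q) * (\<Sum>\<^sub>\<infinity>k. \<Sum>\<^sub>\<infinity>n. t k n)"
    by (simp add: jackson_integral_def row scaleR_conv_of_real)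
  also have "(\<Sum>\<^sub>\<infinity>k. \<Sum>\<^sub>\<infinity>n. t k n) = (\<Sum>\<^sub>\<infinity>n. \<Sum>\<^sub>\<infinity>k. t k n)"
    by (rule infsum_swap_banach[OF sum])
  also have "\<dots> = (\<Sum>n. of_real (c n * \<mu> n) * z ^ (2 * n))"
    unfolding col using has_sum_imp_sums[OF has_sum_infsum[OF cols]] by (simp add: sums_iff)
  finally have "qbessel_transform q \<nu> f z =
      of_real (cq q \<nu> * (1 - q)) * (\<Sum>n. of_real (c n * \<mu> n) * z ^ (2 * n))"
    by (simp add: qbessel_transform_def)
  also have "\<dots> = (\<Sum>n. of_real (cq q \<nu> * (1 - q)) * (of_real (c n * \<mu> n) * z ^ (2 * n)))"
    using summable_on_imp_summable[OF cols] by (rule suminf_mult[symmetric])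
  finally show "qbessel_transform q \<nu> f z =
      (\<Sum>n. of_real (cq q \<nu> * (1 - q) * qbessel_coeff q \<nu> n *
        (\<Sum>\<^sub>\<infinity>k. lattice_weight q \<nu> f k * (q powi k) ^ (2 * n))) * z ^ (2 * n))"
    by (simp add: c_def \<mu>_def w_def mult.assoc)
qed

section \<open>Vanishing of \<open>f\<close> on the lattice\<close>

lemma gaussian_decay_transform_decay_imp_zero:
  assumes f: "\<forall>x \<in> qlattice q. \<bar>f x\<bar> \<le> C * exp (- (1 / 2) * x\<^sup>2)"
    and F: "\<forall>x::real. norm (qbessel_transform q \<nu> f (complex_of_real x)) \<le> C * exp (- (1 / 2) * x\<^sup>2)"
    and z: "z \<in> qlattice q"
  shows "f z = 0"
proof -
  define w where "w = lattice_weight q \<nu> f"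
  have w: "rapid q w"
    unfolding w_def by (rule rapid_lattice_weight[OF f])
  define \<mu> where "\<mu> n = (\<Sum>\<^sub>\<infinity>k. w k * (q powi k) ^ (2 * n))" for n
  define b where "b n = complex_of_real (cq q \<nu> * (1 - q) * qbessel_coeff q \<nu> n * \<mu> n)" for n
  define S where "S z = (\<Sum>n. b n * z ^ (2 * n))" for z
  have F_eq: "qbessel_transform q \<nu> f z = S z" for z
    unfolding S_def b_def \<mu>_def w_def
    by (rule qbessel_transform_power_series) (use w in \<open>simp add: w_def\<close>)
  note F = F[unfolded F_eq]
  obtain R where R: "R \<ge> 0" "\<And>n. \<bar>qbessel_coeff q \<nu> n\<bar> \<le> R ^ n * q ^ (n\<^sup>2)"
    using qbessel_coeff_bound by blast
  define M where "M = (\<Sum>\<^sub>\<infinity>k. \<bar>w k\<bar> * (1 / q) ^ (2 * (nat (- k))\<^sup>2))"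
  have M: "M \<ge> 0" unfolding M_def using q by (intro infsum_nonneg) simp
  define p where "p = sqrt q"
  have p: "0 < p" "p < 1" "q = p\<^sup>2" using q by (auto simp: p_def)
  define W where "W = \<bar>cq q \<nu> * (1 - q)\<bar> * M"
  have W: "W \<ge> 0" using M by (simp add: W_def)
  \<comment> \<open>The Bessel coefficient contributes \<open>q ^ (n^2)\<close> and the moment grows
    at most like \<open>(1 / p) ^ (n^2)\<close>; as \<open>q = p^2\<close>, decay
    \<open>p ^ (n^2)\<close> remains.\<close>
  have b: "norm (b n) \<le> W * (R ^ n * p ^ (n\<^sup>2))" for n
  proof -
    have "norm (b n) = \<bar>cq q \<nu> * (1 - q)\<bar> * (\<bar>qbessel_coeff q \<nu> n\<bar> * \<bar>\<mu> n\<bar>)"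
      unfolding b_def norm_of_real by (simp add: abs_mult mult.assoc)
    also have "\<dots> \<le> \<bar>cq q \<nu> * (1 - q)\<bar> * ((R ^ n * q ^ (n\<^sup>2)) * ((1 / p) ^ (n\<^sup>2) * M))"
      using R rapid_moment_bound[OF q w, of n] q unfolding \<mu>_def M_def p_def
      by (intro mult_left_mono mult_mono) auto
    also have "\<dots> = W * (R ^ n * (q ^ (n\<^sup>2) * (1 / p) ^ (n\<^sup>2)))"
      by (simp add: W_def mult_ac)
    also have "q ^ (n\<^sup>2) * (1 / p) ^ (n\<^sup>2) = p ^ (n\<^sup>2)"
      unfolding power_mult_distrib[symmetric] using p by (simp add: power2_eq_square)
    finally show ?thesis .
  qed
  note entire = even_power_series_entire[OF p(1,2) R(1) W b, folded S_def]
  have "S u = 0" for u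
  proof (rule entire_small_growth_real_decay_eq_0[OF entire(1) entire(2)])
    have C: "C \<ge> 0"
      using order_trans[OF norm_ge_zero spec[OF F, of 0]] by simp
    have "C * exp (- (1 / 2) * x\<^sup>2) \<le> C" for x :: real
      using C by (intro mult_left_le) auto
    with F show "norm (S (complex_of_real x)) \<le> C" for x
      using order_trans by blast
    have "((\<lambda>x::real. C * exp (- (1 / 2) * x\<^sup>2)) \<longlongrightarrow> 0) at_top"
      by real_asymp
    then show "((\<lambda>x. S (complex_of_real x)) \<longlongrightarrow> 0) at_top"
      by (rule Lim_null_comparison[rotated]) (use F in simp)
  qed
  then have b0: "b n = 0" for n
    by (rule entire(3))
  \<comment> \<open>The factors \<open>cq q \<nu>\<close>, \<open>1 - q\<close> and the Bessel
    coefficient are all nonzero, so a vanishing \<open>b n\<close> forces a vanishing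
    moment.\<close>
  have "\<mu> n = 0" for n
    using b0[of n] cq_nonzero q qbessel_coeff_nonzero[of n] by (simp add: b_def)
  then have "w k = 0" for k
    unfolding \<mu>_def by (intro rapid_moments_zero_imp_zero[OF q w])
  moreover obtain k where "z = q powi k" using z by (auto simp: qlattice_def)
  ultimately show ?thesis
    using q unfolding w_def lattice_weight_def by (metis mult_eq_0_iff powr_eq_0_iff power_int_eq_0_iff less_irrefl)
qed

end

theorem theorem7:
  fixes q \<nu> C :: real and f :: "real \<Rightarrow> real"
  assumes "0 < q" and "q < 1" and "\<nu> > -1"
    and "f \<in> L1q q \<nu>"
    and "C > 0"
    and "\<forall>x \<in> qlattice q. \<bar>f x\<bar> \<le> C * exp (- (1 / 2) * x\<^sup>2)"
    and "\<forall>x::real. norm (qbessel_transform q \<nu> f (complex_of_real x))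
           \<le> C * exp (- (1 / 2) * x\<^sup>2)"
  shows "(\<forall>z::complex.
            jackson_integrable q (qbessel_integrand q \<nu> (\<lambda>x. exp (- (1 / 2) * x\<^sup>2)) z)) \<and>
         (\<exists>A::real. \<forall>z \<in> qlattice q.
            complex_of_real (f z) = complex_of_real A * complex_of_real (cq q \<nu>) *
              qbessel_transform q \<nu> (\<lambda>x. exp (- (1 / 2) * x\<^sup>2)) (complex_of_real z))"
proof
  \<comment> \<open>The Gaussian satisfies its own decay bound with constant 1, which gives absolute
    convergence of its transform at every complex point.\<close>
  have "rapid q (lattice_weight q \<nu> (\<lambda>x. exp (- (1 / 2) * x\<^sup>2)))"
    by (rule rapid_lattice_weight[where C = 1]) (use assms in auto)
  then show "\<forall>z. jackson_integrable q (qbessel_integrand q \<nu> (\<lambda>x. exp (- (1 / 2) * x\<^sup>2)) z)"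
    using jackson_integrable_qbessel_integrand assms by blast
  have "f z = 0" if "z \<in> qlattice q" for z
    using gaussian_decay_transform_decay_imp_zero that assms by blast
  then show "\<exists>A::real. \<forall>z \<in> qlattice q.
      complex_of_real (f z) = complex_of_real A * complex_of_real (cq q \<nu>) *
        qbessel_transform q \<nu> (\<lambda>x. exp (- (1 / 2) * x\<^sup>2)) (complex_of_real z)"
    by (intro exI[of _ 0]) simp
qed

end
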